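(* Consider the online approval committee election problem with $n$ voters, $m$ candidates and committee size $k\le m$, with the Chamberlin–Courant approval score $\mathrm{sc}(W)=|\{i\in N : W\cap A(i)\neq\emptyset\}|$, and assume (UI): each voter approves each candidate with the same known probability $p\in[0,1]$, all these approval events being independent. Then an optimal safe policy (a safe policy maximizing the expected score of the selected committee among all safe policies) can be computed in time $O(n^3km)$.
   Context: Setting. There are voters $N=\{1,\dots,n\}$ and $m$ candidates $c_1,\dots,c_m$ appearing one at a time in this order; exactly $k\le m$ of them have to be selected. When $c_t$ appears, the set $N(c_t)\subseteq N$ of voters approving $c_t$ is revealed, and it must be decided immediately and irrevocably whether $c_t$ is selected ("yes") or not ("no"), without knowledge of the approvals of later candidates. $A(i)$ denotes the set of all candidates approved by voter $i$. Assumption (UI). The events "voter $i$ approves candidate $c_t$" ($i\in N$, $1\le t\le m$) are mutually independent and each has probability $p$, which is known in advance. Policies. A history is a sequence $\langle (c_t,N(c_t),a_t) : t=1,\dots,q\rangle$, $q\le m$, with $a_t\in\{\text{yes},\text{no}\}$; it is terminal if $q=m$ or the number of selected candidates is $k$. A policy $\pi$ decides, at each step $t$ and after $N(c_t)$ is observed, whether $c_t$ is selected. A policy is safe if every terminal history it induces selects exactly $k$ candidates. For a terminal history $h$ of a safe policy, $W(h)$ is the set of selected candidates. The expected score of a safe policy $\pi$ is $\mathbb{E}_{h\sim\pi}[\mathrm{sc}(W(h))]$, where the distribution over histories is induced by the random approvals and $\pi$. An optimal safe policy is a safe policy with maximal expected score. Representation of the output. A policy is represented as a table mapping each state $(\alpha,\beta,\gamma,\delta)$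 to an action in $\{\text{yes},\text{no}\}$, where $\alpha\in\{1,\dots,m\}$ is the number of candidates seen so far including the current one, $\beta\in\{0,\dots,\min(k,\alpha-1)\}$ is the number of candidates selected so far, $\delta\in\{0,\dots,n\}$ is the number of voters who approve none of the candidates selected so far, and $\gamma\in\{0,\dots,\delta\}$ is the number of those $\delta$ voters who approve the current candidate. The input is $(n,m,k,p)$, and running time counts elementary arithmetic operations and comparisons on real numbers at unit cost. *)

theory Defs
  imports "HOL-Probability.Probability" "HOL-Probability.Product_PMF"
begin

section \<open>Online elections\<close>

text \<open>Voters are \<open>1, \<dots>, n\<close>; the candidate \<open>c\<^sub>t\<close> is represented by its index \<open>t \<in> {1..m}\<close>.
  In an approval profile \<open>P\<close>, \<open>P (i, t)\<close> says that voter \<open>i\<close> approves candidate \<open>t\<close>.\<close>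

type_synonym profile = "nat \<times> nat \<Rightarrow> bool"

definition approvers :: "nat \<Rightarrow> profile \<Rightarrow> nat \<Rightarrow> nat set" where
  "approvers n P t = {i \<in> {1..n}. P (i, t)}"

definition approved_by :: "nat \<Rightarrow> profile \<Rightarrow> nat \<Rightarrow> nat set" where
  "approved_by m P i = {t \<in> {1..m}. P (i, t)}"

definition profile_pmf :: "nat \<Rightarrow> nat \<Rightarrow> real \<Rightarrow> profile pmf" where
  "profile_pmf n m p = Pi_pmf ({1..n} \<times> {1..m}) False (\<lambda>_. bernoulli_pmf p)"

definition cc_score :: "nat \<Rightarrow> nat \<Rightarrow> profile \<Rightarrow> nat set \<Rightarrow> nat" where
  "cc_score n m P W = card {i \<in> {1..n}. W \<inter> approved_by m P i \<noteq> {}}"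

type_synonym history = "(nat \<times> nat set \<times> bool) list"

text \<open>A policy sees the history so far and the approvers of the current candidate, and nothing
  else; it is deterministic, but may depend on the whole history.\<close>

type_synonym policy = "history \<Rightarrow> nat set \<Rightarrow> bool"

definition selected :: "history \<Rightarrow> nat set" where
  "selected h = {c. \<exists>V. (c, V, True) \<in> set h}"

text \<open>\<open>play n k \<pi> P q\<close> is the history induced by \<open>\<pi>\<close> on the profile \<open>P\<close> when \<open>q\<close> candidates are
  available. It stops growing as soon as \<open>k\<close> candidates are selected, so that \<open>play n k \<pi> P m\<close> is
  the terminal history induced on \<open>P\<close>.\<close>

primrec play :: "nat \<Rightarrow> nat \<Rightarrow> policy \<Rightarrow> profile \<Rightarrow> nat \<Rightarrow> history" where
  "play n k \<pi> P 0 = []"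
| "play n k \<pi> P (Suc q) =
    (let h = play n k \<pi> P q; V = approvers n P (Suc q)
     in if card (selected h) = k then h else h @ [(Suc q, V, \<pi> h V)])"

text \<open>Safety is required on all profiles, including those of probability zero when \<open>p \<in> {0, 1}\<close>.\<close>

definition safe :: "nat \<Rightarrow> nat \<Rightarrow> nat \<Rightarrow> policy \<Rightarrow> bool" where
  "safe n m k \<pi> \<longleftrightarrow> (\<forall>P. card (selected (play n k \<pi> P m)) = k)"

definition expected_score :: "nat \<Rightarrow> nat \<Rightarrow> nat \<Rightarrow> real \<Rightarrow> policy \<Rightarrow> real" where
  "expected_score n m k p \<pi> =
     measure_pmf.expectation (profile_pmf n m p)
       (\<lambda>P. real (cc_score n m P (selected (play n k \<pi> P m))))"

definition optimal_safe :: "nat \<Rightarrow> nat \<Rightarrow> nat \<Rightarrow> real \<Rightarrow> policy \<Rightarrow> bool" where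
  "optimal_safe n m k p \<pi> \<longleftrightarrow>
     safe n m k \<pi> \<and>
     (\<forall>\<pi>'. safe n m k \<pi>' \<longrightarrow> expected_score n m k p \<pi>' \<le> expected_score n m k p \<pi>)"

definition states :: "nat \<Rightarrow> nat \<Rightarrow> nat \<Rightarrow> (nat \<times> nat \<times> nat \<times> nat) set" where
  "states n m k = {(\<alpha>, \<beta>, \<gamma>, \<delta>).
     \<alpha> \<in> {1..m} \<and> \<beta> \<in> {0..min k (\<alpha> - 1)} \<and> \<delta> \<in> {0..n} \<and> \<gamma> \<in> {0..\<delta>}}"

definition uncovered :: "nat \<Rightarrow> history \<Rightarrow> nat set" where
  "uncovered n h = {i \<in> {1..n}. \<forall>(c, V, a) \<in> set h. a \<longrightarrow> i \<notin> V}"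

definition table_policy :: "nat \<Rightarrow> (nat \<times> nat \<times> nat \<times> nat \<Rightarrow> bool) \<Rightarrow> policy" where
  "table_policy n T h V =
     T (length h + 1, card (selected h), card (uncovered n h \<inter> V), card (uncovered n h))"


section \<open>Unit-cost programs over the reals\<close>

text \<open>A real RAM in structured form. The memory consists of natural-number registers, used for
  control and addressing, and of arrays of reals indexed by tuples of natural numbers; the array
  cell with the empty index serves as a real register. The only integer operations are addition
  and truncated subtraction, and there is no conversion from reals to naturals. The only constants
  of a program are natural numbers, so that no information can be hidden in a real constant.\<close>

type_synonym vname = string

datatype nexp =
    NConst nat
  | NVar vname
  | NAdd nexp nexp
  | NSub nexp nexp

datatype rexp =
    RNat nexp
  | RCell vname "nexp list"
  | RAdd rexp rexp
  | RSub rexp rexp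
  | RMul rexp rexp
  | RDiv rexp rexp

datatype bexp =
    BNLess nexp nexp
  | BRLess rexp rexp
  | BNot bexp
  | BAnd bexp bexp

datatype com =
    Skip
  | NAssign vname nexp
  | RAssign vname "nexp list" rexp
  | Seq com com
  | If bexp com com
  | While bexp com

record memory =
  nreg :: "vname \<Rightarrow> nat"
  rarr :: "vname \<Rightarrow> nat list \<Rightarrow> real"

primrec nval :: "nexp \<Rightarrow> memory \<Rightarrow> nat" where
  "nval (NConst c) s = c"
| "nval (NVar x) s = nreg s x"
| "nval (NAdd a b) s = nval a s + nval b s"
| "nval (NSub a b) s = nval a s - nval b s"

primrec rval :: "rexp \<Rightarrow> memory \<Rightarrow> real" where
  "rval (RNat a) s = real (nval a s)"
| "rval (RCell A is) s = rarr s A (map (\<lambda>i. nval i s) is)"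
| "rval (RAdd a b) s = rval a s + rval b s"
| "rval (RSub a b) s = rval a s - rval b s"
| "rval (RMul a b) s = rval a s * rval b s"
| "rval (RDiv a b) s = rval a s / rval b s"

primrec bval :: "bexp \<Rightarrow> memory \<Rightarrow> bool" where
  "bval (BNLess a b) s \<longleftrightarrow> nval a s < nval b s"
| "bval (BRLess a b) s \<longleftrightarrow> rval a s < rval b s"
| "bval (BNot b) s \<longleftrightarrow> \<not> bval b s"
| "bval (BAnd b c) s \<longleftrightarrow> bval b s \<and> bval c s"

text \<open>Every constant, memory access, arithmetic operation, comparison and Boolean connective
  costs one unit.\<close>

primrec ncost :: "nexp \<Rightarrow> nat" where
  "ncost (NConst c) = 1"
| "ncost (NVar x) = 1"
| "ncost (NAdd a b) = 1 + ncost a + ncost b"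
| "ncost (NSub a b) = 1 + ncost a + ncost b"

primrec rcost :: "rexp \<Rightarrow> nat" where
  "rcost (RNat a) = 1 + ncost a"
| "rcost (RCell A is) = 1 + sum_list (map ncost is)"
| "rcost (RAdd a b) = 1 + rcost a + rcost b"
| "rcost (RSub a b) = 1 + rcost a + rcost b"
| "rcost (RMul a b) = 1 + rcost a + rcost b"
| "rcost (RDiv a b) = 1 + rcost a + rcost b"

primrec bcost :: "bexp \<Rightarrow> nat" where
  "bcost (BNLess a b) = 1 + ncost a + ncost b"
| "bcost (BRLess a b) = 1 + rcost a + rcost b"
| "bcost (BNot b) = 1 + bcost b"
| "bcost (BAnd b c) = 1 + bcost b + bcost c"

text \<open>\<open>exec c s t s'\<close>: program \<open>c\<close>, started in memory \<open>s\<close>, halts in memory \<open>s'\<close> after \<open>t\<close> units of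
  time.\<close>

inductive exec :: "com \<Rightarrow> memory \<Rightarrow> nat \<Rightarrow> memory \<Rightarrow> bool" where
  exec_Skip: "exec Skip s 1 s"
| exec_NAssign:
    "exec (NAssign x a) s (1 + ncost a) (s\<lparr>nreg := (nreg s)(x := nval a s)\<rparr>)"
| exec_RAssign:
    "js = map (\<lambda>i. nval i s) is \<Longrightarrow>
     exec (RAssign A is e) s (1 + sum_list (map ncost is) + rcost e)
       (s\<lparr>rarr := (rarr s)(A := (rarr s A)(js := rval e s))\<rparr>)"
| exec_Seq:
    "exec c s t s' \<Longrightarrow> exec d s' u s'' \<Longrightarrow> exec (Seq c d) s (t + u) s''"
| exec_IfTrue:
    "bval b s \<Longrightarrow> exec c s t s' \<Longrightarrow> exec (If b c d) s (1 + bcost b + t) s'"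
| exec_IfFalse:
    "\<not> bval b s \<Longrightarrow> exec d s t s' \<Longrightarrow> exec (If b c d) s (1 + bcost b + t) s'"
| exec_WhileFalse:
    "\<not> bval b s \<Longrightarrow> exec (While b c) s (1 + bcost b) s"
| exec_WhileTrue:
    "bval b s \<Longrightarrow> exec c s t s' \<Longrightarrow> exec (While b c) s' u s'' \<Longrightarrow>
     exec (While b c) s (1 + bcost b + t + u) s''"

inductive_cases exec_SkipE: "exec Skip s t s'"
inductive_cases exec_NAssignE: "exec (NAssign x a) s t s'"
inductive_cases exec_RAssignE: "exec (RAssign A is e) s t s'"
inductive_cases exec_SeqE: "exec (Seq c d) s t s'"
inductive_cases exec_IfE: "exec (If b c d) s t s'"
inductive_cases exec_WhileE: "exec (While b c) s t s'"

lemma exec_deterministic: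
  "exec c s t s' \<Longrightarrow> exec c s u s'' \<Longrightarrow> u = t \<and> s'' = s'"
proof (induction arbitrary: u s'' rule: exec.induct)
  case exec_Skip
  then show ?case by (auto elim: exec_SkipE)
next
  case exec_NAssign
  then show ?case by (auto elim: exec_NAssignE)
next
  case exec_RAssign
  then show ?case by (auto elim: exec_RAssignE)
next
  case exec_Seq
  from exec_Seq.prems show ?case
    by (rule exec_SeqE) (auto dest!: exec_Seq.IH)
next
  case exec_IfTrue
  from exec_IfTrue.prems show ?case
    by (rule exec_IfE) (auto simp: exec_IfTrue.hyps dest!: exec_IfTrue.IH)
next
  case exec_IfFalse
  from exec_IfFalse.prems show ?case
    by (rule exec_IfE) (auto simp: exec_IfFalse.hyps dest!: exec_IfFalse.IH)
next
  case exec_WhileFalse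
  from exec_WhileFalse.prems show ?case
    by (rule exec_WhileE) (auto simp: exec_WhileFalse.hyps)
next
  case exec_WhileTrue
  from exec_WhileTrue.prems show ?case
    by (rule exec_WhileE) (auto simp: exec_WhileTrue.hyps(1) dest!: exec_WhileTrue.IH)
qed

text \<open>Apart from the input, the initial memory is arbitrary: a program cannot rely on cells being
  initialised, and has to write every entry of the output table.\<close>

definition input_memory :: "nat \<Rightarrow> nat \<Rightarrow> nat \<Rightarrow> real \<Rightarrow> memory \<Rightarrow> bool" where
  "input_memory n m k p s \<longleftrightarrow>
     nreg s ''n'' = n \<and> nreg s ''m'' = m \<and> nreg s ''k'' = k \<and> rarr s ''p'' [] = p"

text \<open>The table is read off from the array \<open>action\<close>, where 1 stands for yes and 0 for no.\<close>

definition output_table :: "memory \<Rightarrow> nat \<times> nat \<times> nat \<times> nat \<Rightarrow> real" where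
  "output_table s = (\<lambda>(\<alpha>, \<beta>, \<gamma>, \<delta>). rarr s ''action'' [\<alpha>, \<beta>, \<gamma>, \<delta>])"

definition outputs_optimal_policy :: "nat \<Rightarrow> nat \<Rightarrow> nat \<Rightarrow> real \<Rightarrow> memory \<Rightarrow> bool" where
  "outputs_optimal_policy n m k p s \<longleftrightarrow>
     (\<forall>x \<in> states n m k. output_table s x \<in> {0, 1}) \<and>
     optimal_safe n m k p (table_policy n (\<lambda>x. output_table s x = 1))"

end

theory Submission
  imports Defs
begin

text \<open>By (UI), all that matters about the past is the number of candidates left, of free seats and
  of uncovered voters, and the number of uncovered voters approving the next candidate is binomially
  distributed. Backward induction on these three numbers gives the optimal expected gain. The number
  of covered voters plus this gain, taken along the history, is a supermartingale for every safe
  policy (which may depend on the whole history) and a martingale for the policy choosing the better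
  action in every state, so the latter is optimal. Tabulating the binomial weights by Pascal's
  recurrence leaves constant work per state, which even yields \<open>O(n\<^sup>2 k m)\<close>.\<close>

section \<open>Histories\<close>

text \<open>The profile enters one step only through \<open>V\<close>, so the fresh column can be
  averaged while the past stays fixed.\<close>

definition next_history :: "nat \<Rightarrow> policy \<Rightarrow> nat \<Rightarrow> history \<Rightarrow> nat set \<Rightarrow> history" where
  "next_history k \<pi> q h V =
     (if card (selected h) = k then h else h @ [(Suc q, V, \<pi> h V)])"

lemma play_Suc_next_history:
  "play n k \<pi> P (Suc q) = next_history k \<pi> q (play n k \<pi> P q) (approvers n P (Suc q))"
  by (simp add: next_history_def Let_def)

declare play.simps(2) [simp del]

text \<open>No lookahead: the first q steps read only the first q columns, so later columns can be
  redrawn without changing the history.\<close>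

lemma play_cong:
  assumes "\<And>i t. i \<in> {1..n} \<Longrightarrow> t \<in> {1..q} \<Longrightarrow> P (i, t) = P' (i, t)"
  shows "play n k \<pi> P q = play n k \<pi> P' q"
  using assms
proof (induction q)
  case (Suc q)
  have "approvers n P (Suc q) = approvers n P' (Suc q)"
    using Suc.prems by (auto simp: approvers_def)
  moreover have "play n k \<pi> P q = play n k \<pi> P' q"
    by (rule Suc.IH) (use Suc.prems in auto)
  ultimately show ?case
    by (simp add: play_Suc_next_history)
qed simp

lemma mem_play:
  "(c, V, a) \<in> set (play n k \<pi> P q) \<Longrightarrow> c \<in> {1..q} \<and> V = approvers n P c"
  by (induction q) (auto simp: play_Suc_next_history next_history_def split: if_splits)

lemma selected_play_subset: "selected (play n k \<pi> P q) \<subseteq> {1..q}"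
  by (auto simp: selected_def dest: mem_play)

text \<open>As long as seats are free every step appends an entry, so \<open>length h + 1\<close> in
  \<open>table_policy\<close> is the index of the current candidate.\<close>

lemma length_play:
  "card (selected (play n k \<pi> P q)) \<noteq> k \<Longrightarrow> length (play n k \<pi> P q) = q"
proof (induction q)
  case (Suc q)
  have "card (selected (play n k \<pi> P q)) \<noteq> k"
    using Suc.prems by (auto simp: play_Suc_next_history next_history_def)
  then show ?case
    using Suc.IH by (simp add: play_Suc_next_history next_history_def)
qed simp

lemma selected_snoc:
  "selected (h @ [(c, V, a)]) = (if a then insert c (selected h) else selected h)"
  by (auto simp: selected_def)

lemma uncovered_snoc:
  "uncovered n (h @ [(c, V, a)]) = (if a then uncovered n h - V else uncovered n h)"
  by (auto simp: uncovered_def)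

lemma uncovered_subset: "uncovered n h \<subseteq> {1..n}"
  by (auto simp: uncovered_def)

lemma card_uncovered_le: "card (uncovered n h) \<le> n"
  using card_mono[OF _ uncovered_subset] by fastforce

lemma card_selected_snoc:
  "card (selected (play n k \<pi> P q @ [(Suc q, V, a)])) =
     card (selected (play n k \<pi> P q)) + (if a then 1 else 0)"
proof -
  have "finite (selected (play n k \<pi> P q))" "Suc q \<notin> selected (play n k \<pi> P q)"
    using selected_play_subset[of n k \<pi> P q] finite_subset by fastforce+
  then show ?thesis
    by (simp add: selected_snoc)
qed

lemma card_uncovered_snoc:
  "card (uncovered n (h @ [(c, V, a)])) =
     (if a then card (uncovered n h) - card (uncovered n h \<inter> V) else card (uncovered n h))"
  by (simp add: uncovered_snoc card_Diff_subset_Int finite_subset[OF uncovered_subset])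

lemma card_selected_play_add:
  "card (selected (play n k \<pi> P q)) \<le> card (selected (play n k \<pi> P (q + d))) \<and>
   card (selected (play n k \<pi> P (q + d))) \<le> card (selected (play n k \<pi> P q)) + d"
  by (induction d)
    (auto simp: play_Suc_next_history next_history_def card_selected_snoc split: if_splits)

text \<open>Going back from the final count k, at most one selection is lost per candidate.\<close>

lemma safe_card_selected:
  assumes "safe n m k \<pi>" "q \<le> m"
  shows "card (selected (play n k \<pi> P q)) \<le> k" "k \<le> card (selected (play n k \<pi> P q)) + (m - q)"
  using card_selected_play_add[of n k \<pi> P q "m - q"] assms by (auto simp: safe_def)

text \<open>A voter is covered exactly when it lies in the recorded approver set of a selected
  candidate, because \<open>play\<close> records the true approvers.\<close>

lemma cc_score_play:
  "real (cc_score n m P (selected (play n k \<pi> P m))) =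
     real n - real (card (uncovered n (play n k \<pi> P m)))"
proof -
  let ?h = "play n k \<pi> P m"
  have "{i \<in> {1..n}. selected ?h \<inter> approved_by m P i \<noteq> {}} = {1..n} - uncovered n ?h"
  proof (intro set_eqI iffI)
    fix i assume "i \<in> {i \<in> {1..n}. selected ?h \<inter> approved_by m P i \<noteq> {}}"
    then obtain c V where "i \<in> {1..n}" "P (i, c)" "(c, V, True) \<in> set ?h"
      by (auto simp: selected_def approved_by_def)
    then show "i \<in> {1..n} - uncovered n ?h"
      using mem_play[of c V True] by (fastforce simp: uncovered_def approvers_def)
  next
    fix i assume "i \<in> {1..n} - uncovered n ?h"
    then obtain c V where "i \<in> {1..n}" "(c, V, True) \<in> set ?h" "i \<in> V"
      by (auto simp: uncovered_def)
    moreover from this have "c \<in> {1..m}" "V = approvers n P c"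
      using mem_play[of c V True] by auto
    ultimately show "i \<in> {i \<in> {1..n}. selected ?h \<inter> approved_by m P i \<noteq> {}}"
      by (auto simp: selected_def approved_by_def approvers_def)
  qed
  then show ?thesis
    unfolding cc_score_def
    using card_Diff_subset[OF finite_subset[OF uncovered_subset] uncovered_subset, of n ?h]
      card_uncovered_le[of n ?h]
    by (simp add: of_nat_diff)
qed


section \<open>Revealing one candidate\<close>

definition column_pmf :: "nat \<Rightarrow> nat \<Rightarrow> real \<Rightarrow> profile pmf" where
  "column_pmf n t p = Pi_pmf ({1..n} \<times> {t}) False (\<lambda>_. bernoulli_pmf p)"

definition join_column :: "nat \<Rightarrow> nat \<Rightarrow> profile \<Rightarrow> profile \<Rightarrow> profile" where
  "join_column n q P X = (\<lambda>x. if x \<in> {1..n} \<times> {1..q} then P x else X x)"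

text \<open>Finite support makes every real function integrable, which discharges the integrability
  conditions below.\<close>

lemma finite_set_Pi_pmf_bool: "finite A \<Longrightarrow> finite (set_pmf (Pi_pmf A d (\<lambda>_. M :: bool pmf)))"
  by (rule finite_subset[OF set_Pi_pmf_subset' finite_PiE_dflt]) auto

lemma finite_set_column_pmf [simp]: "finite (set_pmf (column_pmf n t p))"
  unfolding column_pmf_def by (rule finite_set_Pi_pmf_bool) simp

lemma finite_set_profile_pmf [simp]: "finite (set_pmf (profile_pmf n q p))"
  unfolding profile_pmf_def by (rule finite_set_Pi_pmf_bool) simp

lemma integrable_column_pmf [simp]: "integrable (measure_pmf (column_pmf n t p)) (f :: _ \<Rightarrow> real)"
  and integrable_profile_pmf [simp]: "integrable (measure_pmf (profile_pmf n q p)) (f :: _ \<Rightarrow> real)"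
  by (rule integrable_measure_pmf_finite; simp)+

text \<open>Independence across candidates: a product distribution over a disjoint union of index
  sets factors.\<close>

lemma profile_pmf_Suc:
  "profile_pmf n (Suc q) p =
     map_pmf (\<lambda>(P, X). join_column n q P X) (pair_pmf (profile_pmf n q p) (column_pmf n (Suc q) p))"
proof -
  have "{1..n} \<times> {1..Suc q} = {1..n} \<times> {1..q} \<union> {1..n} \<times> {Suc q}"
    by auto
  then show ?thesis
    unfolding profile_pmf_def column_pmf_def join_column_def
    by (subst Pi_pmf_union[symmetric]) (auto simp: Times_Int_distrib1)
qed

lemma play_join_column: "play n k \<pi> (join_column n q P X) q = play n k \<pi> P q"
  by (rule play_cong) (auto simp: join_column_def)

lemma play_join_column_Suc:
  "play n k \<pi> (join_column n q P X) (Suc q) =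
     next_history k \<pi> q (play n k \<pi> P q) (approvers n X (Suc q))"
  by (simp add: play_Suc_next_history play_join_column)
    (simp add: approvers_def join_column_def)

lemma expectation_pair_pmf_finite:
  fixes f :: "'a \<times> 'b \<Rightarrow> real"
  assumes "finite (set_pmf M)" "finite (set_pmf N)"
  shows "measure_pmf.expectation (pair_pmf M N) f =
    measure_pmf.expectation M (\<lambda>x. measure_pmf.expectation N (\<lambda>y. f (x, y)))"
proof -
  have "pair_pmf M N = M \<bind> (\<lambda>x. map_pmf (Pair x) N)"
    by (simp add: pair_pmf_def map_pmf_def)
  then have "measure_pmf.expectation (pair_pmf M N) f =
      (\<Sum>x\<in>set_pmf M. pmf M x *\<^sub>R measure_pmf.expectation (map_pmf (Pair x) N) f)"
    using pmf_expectation_bind[of "set_pmf M" "\<lambda>x. map_pmf (Pair x) N" M f] assms by simp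
  also have "\<dots> = measure_pmf.expectation M (\<lambda>x. measure_pmf.expectation N (\<lambda>y. f (x, y)))"
    using assms by (subst integral_measure_pmf_real[of "set_pmf M"]) (auto simp: mult.commute)
  finally show ?thesis .
qed

text \<open>Tower property: fix the first q columns, then average over the next one.\<close>

lemma expectation_play_Suc:
  fixes F :: "history \<Rightarrow> real"
  shows "measure_pmf.expectation (profile_pmf n (Suc q) p) (\<lambda>P. F (play n k \<pi> P (Suc q))) =
    measure_pmf.expectation (profile_pmf n q p) (\<lambda>P.
      measure_pmf.expectation (column_pmf n (Suc q) p) (\<lambda>X.
        F (next_history k \<pi> q (play n k \<pi> P q) (approvers n X (Suc q)))))"
  by (simp add: profile_pmf_Suc expectation_pair_pmf_finite case_prod_unfold play_join_column_Suc)

text \<open>The binomial coefficient makes this vanish for g > d, so a rectangular table of weights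
  makes sense.\<close>

definition binom_weight :: "real \<Rightarrow> nat \<Rightarrow> nat \<Rightarrow> real" where
  "binom_weight p d g = real (d choose g) * p ^ g * (1 - p) ^ (d - g)"

text \<open>The approvals by voters in \<open>U\<close> within one column are independent Bernoulli
  trials, so their number is binomial with parameters \<open>card U\<close> and p.\<close>

lemma expectation_card_approvers:
  fixes f :: "nat \<Rightarrow> real"
  assumes "0 \<le> p" "p \<le> 1" "U \<subseteq> {1..n}"
  shows "measure_pmf.expectation (column_pmf n t p) (\<lambda>X. f (card (U \<inter> approvers n X t))) =
    (\<Sum>g\<le>card U. binom_weight p (card U) g * f g)"
proof -
  have fin: "finite U"
    using assms(3) finite_subset by blast
  have "binomial_pmf (card U) p =
      map_pmf (\<lambda>X. card {x \<in> U \<times> {t}. X x}) (Pi_pmf (U \<times> {t}) False (\<lambda>_. bernoulli_pmf p))"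
    using assms fin by (intro binomial_pmf_altdef') (auto simp: card_cartesian_product)
  also have "Pi_pmf (U \<times> {t}) False (\<lambda>_. bernoulli_pmf p) =
      map_pmf (\<lambda>X x. if x \<in> U \<times> {t} then X x else False) (column_pmf n t p)"
    unfolding column_pmf_def using assms(3) by (intro Pi_pmf_subset) auto
  also have "map_pmf (\<lambda>X. card {x \<in> U \<times> {t}. X x}) \<dots> =
      map_pmf (\<lambda>X. card (U \<inter> approvers n X t)) (column_pmf n t p)"
    unfolding map_pmf_comp
  proof (intro map_pmf_cong refl)
    fix X :: profile
    have "{x \<in> U \<times> {t}. if x \<in> U \<times> {t} then X x else False} =
        (\<lambda>i. (i, t)) ` (U \<inter> approvers n X t)"
      using assms(3) by (auto simp: approvers_def)
    then show "card {x \<in> U \<times> {t}. if x \<in> U \<times> {t} then X x else False} =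
        card (U \<inter> approvers n X t)"
      by (simp add: card_image inj_on_def)
  qed
  finally have "binomial_pmf (card U) p =
      map_pmf (\<lambda>X. card (U \<inter> approvers n X t)) (column_pmf n t p)" .
  then have "measure_pmf.expectation (column_pmf n t p) (\<lambda>X. f (card (U \<inter> approvers n X t))) =
      measure_pmf.expectation (binomial_pmf (card U) p) f"
    by simp
  then show ?thesis
    using assms by (simp add: expectation_binomial_pmf' binom_weight_def)
qed


section \<open>The value function and the optimal table\<close>

text \<open>\<open>gain p r j d\<close> is the optimal expected number of newly covered voters when \<open>r\<close> candidates are
  still to come, \<open>j\<close> seats are free, and \<open>d\<close> voters are uncovered. It is meaningful for \<open>j \<le> r\<close>
  only; the test \<open>r < j\<close> makes the selection compulsory when all remaining candidates are needed.\<close>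

primrec gain :: "real \<Rightarrow> nat \<Rightarrow> nat \<Rightarrow> nat \<Rightarrow> real" where
  "gain p 0 j d = 0"
| "gain p (Suc r) j d = (\<Sum>g\<le>d. binom_weight p d g *
     (if 0 < j \<and> (r < j \<or> gain p r j d < real g + gain p r (j - 1) (d - g))
      then real g + gain p r (j - 1) (d - g) else gain p r j d))"

text \<open>Here r counts the candidates after the current one. The strict comparison resolves ties
  to no.\<close>

definition takes :: "real \<Rightarrow> nat \<Rightarrow> nat \<Rightarrow> nat \<Rightarrow> nat \<Rightarrow> bool" where
  "takes p r j g d \<longleftrightarrow> 0 < j \<and> (r < j \<or> gain p r j d < real g + gain p r (j - 1) (d - g))"

text \<open>The state-action value of dynamic programming, once g has been revealed.\<close>

definition action_value :: "real \<Rightarrow> nat \<Rightarrow> nat \<Rightarrow> nat \<Rightarrow> nat \<Rightarrow> bool \<Rightarrow> real" where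
  "action_value p r j g d a = (if a then real g + gain p r (j - 1) (d - g) else gain p r j d)"

lemma gain_Suc:
  "gain p (Suc r) j d =
     (\<Sum>g\<le>d. binom_weight p d g * action_value p r j g d (takes p r j g d))"
  by (simp add: takes_def action_value_def)

lemma gain_0_seats: "gain p r 0 d = 0"
  by (induction r) auto

text \<open>Bellman step: if r < j both actions are yes, otherwise \<open>takes\<close> picks the
  larger of the two values.\<close>

lemma action_value_le:
  assumes "0 < j" "r < j \<longrightarrow> a"
  shows "action_value p r j g d a \<le> action_value p r j g d (takes p r j g d)"
  using assms by (auto simp: action_value_def takes_def)

section \<open>The supermartingale bound for all safe policies\<close>

definition potential :: "nat \<Rightarrow> nat \<Rightarrow> nat \<Rightarrow> real \<Rightarrow> nat \<Rightarrow> history \<Rightarrow> real" where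
  "potential n m k p q h =
     real n - real (card (uncovered n h)) +
     gain p (m - q) (k - card (selected h)) (card (uncovered n h))"

text \<open>The g voters newly covered by a yes leave the uncovered set and reappear as the summand
  g of \<open>action_value\<close>.\<close>

lemma potential_snoc:
  assumes "q < m" "card (selected (play n k \<pi> P q)) < k"
  shows "potential n m k p (Suc q) (play n k \<pi> P q @ [(Suc q, V, a)]) =
    real n - real (card (uncovered n (play n k \<pi> P q))) +
    action_value p (m - Suc q) (k - card (selected (play n k \<pi> P q)))
      (card (uncovered n (play n k \<pi> P q) \<inter> V)) (card (uncovered n (play n k \<pi> P q))) a"
proof -
  have "card (uncovered n (play n k \<pi> P q) \<inter> V) \<le> card (uncovered n (play n k \<pi> P q))"
    by (intro card_mono finite_subset[OF uncovered_subset]) auto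
  then show ?thesis
    by (auto simp: potential_def action_value_def card_selected_snoc card_uncovered_snoc of_nat_diff)
qed

lemma expectation_optimal_action:
  assumes "0 \<le> p" "p \<le> 1" "U \<subseteq> {1..n}"
  shows "measure_pmf.expectation (column_pmf n t p) (\<lambda>X. c + action_value p r j
      (card (U \<inter> approvers n X t)) (card U) (takes p r j (card (U \<inter> approvers n X t)) (card U))) =
    c + gain p (Suc r) j (card U)"
proof -
  have "measure_pmf.expectation (column_pmf n t p) (\<lambda>X. c + action_value p r j
      (card (U \<inter> approvers n X t)) (card U) (takes p r j (card (U \<inter> approvers n X t)) (card U))) =
    c + measure_pmf.expectation (column_pmf n t p) (\<lambda>X. action_value p r j
      (card (U \<inter> approvers n X t)) (card U) (takes p r j (card (U \<inter> approvers n X t)) (card U)))"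
    by (subst Bochner_Integration.integral_add) auto
  also have "\<dots> = c + gain p (Suc r) j (card U)"
    using expectation_card_approvers[OF assms,
        of t "\<lambda>g. action_value p r j g (card U) (takes p r j g (card U))"]
    by (simp only: gain_Suc)
  finally show ?thesis .
qed

text \<open>The history freezes once k candidates are selected, while q still advances; without free
  seats the gain is 0 for any number of remaining candidates.\<close>

lemma potential_stopped:
  "card (selected h) = k \<Longrightarrow> potential n m k p q h = potential n m k p q' h"
  by (simp add: potential_def gain_0_seats)

text \<open>Given the past, no action open to a safe policy beats \<open>takes\<close>, and the
  average under \<open>takes\<close> is exactly the old potential.\<close>

lemma expectation_potential_Suc_le:
  assumes "0 \<le> p" "p \<le> 1" "safe n m k \<pi>" "q < m"
  shows "measure_pmf.expectation (profile_pmf n (Suc q) p)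
      (\<lambda>P. potential n m k p (Suc q) (play n k \<pi> P (Suc q))) \<le>
    measure_pmf.expectation (profile_pmf n q p) (\<lambda>P. potential n m k p q (play n k \<pi> P q))"
  unfolding expectation_play_Suc
proof (intro integral_mono integrable_profile_pmf)
  fix P
  let ?h = "play n k \<pi> P q" and ?V = "\<lambda>X. approvers n X (Suc q)"
  show "measure_pmf.expectation (column_pmf n (Suc q) p)
      (\<lambda>X. potential n m k p (Suc q) (next_history k \<pi> q ?h (?V X))) \<le> potential n m k p q ?h"
  proof (cases "card (selected ?h) = k")
    case True
    then show ?thesis
      using potential_stopped[OF True, of n m p q "Suc q"] by (simp add: next_history_def)
  next
    case False
    then have less: "card (selected ?h) < k"
      using safe_card_selected(1)[OF assms(3), of q P] assms(4) by simp
    let ?j = "k - card (selected ?h)" and ?U = "uncovered n ?h" and ?r = "m - Suc q"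
    have "potential n m k p (Suc q) (next_history k \<pi> q ?h (?V X)) \<le>
        (real n - real (card ?U)) + action_value p ?r ?j (card (?U \<inter> ?V X)) (card ?U)
          (takes p ?r ?j (card (?U \<inter> ?V X)) (card ?U))" for X
    proof -
      \<comment> \<open>Safety on the profile glued from P and X: if the candidates after the
        current one cannot fill the free seats, the policy must answer yes to this approver set,
        whatever the probability of X.\<close>
      have "k \<le> card (selected (play n k \<pi> (join_column n q P X) (Suc q))) + ?r"
        using assms by (intro safe_card_selected) auto
      then have "?r < ?j \<longrightarrow> \<pi> ?h (?V X)"
        using False
        by (auto simp: play_join_column_Suc next_history_def card_selected_snoc split: if_splits)
      then show ?thesis
        using False less action_value_le[of ?j ?r "\<pi> ?h (?V X)"]
        by (simp add: next_history_def potential_snoc[OF assms(4) less])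
    qed
    then have "measure_pmf.expectation (column_pmf n (Suc q) p)
        (\<lambda>X. potential n m k p (Suc q) (next_history k \<pi> q ?h (?V X))) \<le>
      measure_pmf.expectation (column_pmf n (Suc q) p)
        (\<lambda>X. (real n - real (card ?U)) + action_value p ?r ?j (card (?U \<inter> ?V X)) (card ?U)
          (takes p ?r ?j (card (?U \<inter> ?V X)) (card ?U)))"
      by (intro integral_mono integrable_column_pmf)
    also have "\<dots> = real n - real (card ?U) + gain p (Suc ?r) ?j (card ?U)"
      by (rule expectation_optimal_action[OF assms(1,2) uncovered_subset])
    also have "\<dots> = potential n m k p q ?h"
      using assms(4) by (simp add: potential_def Suc_diff_Suc del: gain.simps)
    finally show ?thesis .
  qed
qed

lemma expectation_potential_final:
  assumes "safe n m k \<pi>"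
  shows "measure_pmf.expectation (profile_pmf n m p) (\<lambda>P. potential n m k p m (play n k \<pi> P m)) =
    expected_score n m k p \<pi>"
  unfolding expected_score_def cc_score_play potential_def by simp

lemma expectation_potential_0:
  "measure_pmf.expectation (profile_pmf n 0 p) (\<lambda>P. potential n m k p 0 (play n k \<pi> P 0)) =
    gain p m k n"
proof -
  have "uncovered n [] = {1..n}"
    by (auto simp: uncovered_def)
  then show ?thesis
    by (simp add: potential_def selected_def)
qed

lemma expected_score_le_gain:
  assumes "0 \<le> p" "p \<le> 1" "safe n m k \<pi>"
  shows "expected_score n m k p \<pi> \<le> gain p m k n"
proof -
  have "measure_pmf.expectation (profile_pmf n q p) (\<lambda>P. potential n m k p q (play n k \<pi> P q)) \<le>
      gain p m k n" if "q \<le> m" for q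
    using that
  proof (induction q)
    case 0
    show ?case by (simp only: expectation_potential_0 order_refl)
  next
    case (Suc q)
    then show ?case
      using expectation_potential_Suc_le[OF assms, of q] by simp
  qed
  then show ?thesis
    using expectation_potential_final[OF assms(3)] by (metis order_refl)
qed

text \<open>A predicate rather than one fixed table, since the output of a program is arbitrary
  outside \<open>states\<close>.\<close>

definition optimal_table ::
    "nat \<Rightarrow> nat \<Rightarrow> nat \<Rightarrow> real \<Rightarrow> (nat \<times> nat \<times> nat \<times> nat \<Rightarrow> bool) \<Rightarrow> bool" where
  "optimal_table n m k p T \<longleftrightarrow>
     (\<forall>(\<alpha>, \<beta>, \<gamma>, \<delta>) \<in> states n m k. T (\<alpha>, \<beta>, \<gamma>, \<delta>) = takes p (m - \<alpha>) (k - \<beta>) \<gamma> \<delta>)"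

section \<open>The martingale property and optimality of the table policy\<close>

context
  fixes n m k :: nat and p :: real and T
  assumes k: "k \<le> m" and p: "0 \<le> p" "p \<le> 1" and T: "optimal_table n m k p T"
begin

text \<open>With seats free, the history has length q and at most q selections, so its state lies in
  \<open>states\<close>, where the table is prescribed.\<close>

lemma table_policy_play:
  assumes "q < m" "card (selected (play n k (table_policy n T) P q)) < k"
  defines "h \<equiv> play n k (table_policy n T) P q"
  shows "table_policy n T h V = takes p (m - Suc q) (k - card (selected h))
    (card (uncovered n h \<inter> V)) (card (uncovered n h))"
proof -
  have "length h = q"
    unfolding h_def using assms(2) by (intro length_play) simp
  moreover have "card (selected h) \<le> q"
    unfolding h_def using card_mono[OF _ selected_play_subset] by fastforce
  moreover have "card (uncovered n h \<inter> V) \<le> card (uncovered n h)"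
    by (intro card_mono finite_subset[OF uncovered_subset]) auto
  ultimately have "(length h + 1, card (selected h), card (uncovered n h \<inter> V), card (uncovered n h))
      \<in> states n m k"
    using assms card_uncovered_le[of n h] by (auto simp: states_def)
  then show ?thesis
    using T \<open>length h = q\<close> by (auto simp: optimal_table_def table_policy_def)
qed

text \<open>The compulsory clause r < j of \<open>takes\<close> keeps the number of free seats
  within the number of remaining candidates.\<close>

lemma table_policy_card_selected:
  assumes "q \<le> m"
  shows "card (selected (play n k (table_policy n T) P q)) \<le> k \<and>
    k \<le> card (selected (play n k (table_policy n T) P q)) + (m - q)"
  using assms
proof (induction q)
  case 0
  then show ?case using k by (simp add: selected_def)
next
  case (Suc q)
  let ?h = "play n k (table_policy n T) P q"
  show ?case
  proof (cases "card (selected ?h) = k")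
    case True
    then show ?thesis by (simp add: play_Suc_next_history next_history_def)
  next
    case False
    then have less: "card (selected ?h) < k"
      using Suc by simp
    have "m - Suc q < k - card (selected ?h) \<longrightarrow> table_policy n T ?h (approvers n P (Suc q))"
      using table_policy_play[OF _ less] less Suc.prems by (auto simp: takes_def)
    then show ?thesis
      using False less Suc
      by (auto simp: play_Suc_next_history next_history_def card_selected_snoc)
  qed
qed

lemma safe_table_policy: "safe n m k (table_policy n T)"
  unfolding safe_def using table_policy_card_selected[OF order_refl] by (simp add: eq_iff)

text \<open>As in the supermartingale step, but the action is \<open>takes\<close> itself, hence
  equality.\<close>

lemma expectation_potential_Suc_eq:
  assumes "q < m"
  shows "measure_pmf.expectation (profile_pmf n (Suc q) p)
      (\<lambda>P. potential n m k p (Suc q) (play n k (table_policy n T) P (Suc q))) =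
    measure_pmf.expectation (profile_pmf n q p)
      (\<lambda>P. potential n m k p q (play n k (table_policy n T) P q))"
  unfolding expectation_play_Suc
proof (intro Bochner_Integration.integral_cong refl)
  fix P
  let ?h = "play n k (table_policy n T) P q" and ?V = "\<lambda>X. approvers n X (Suc q)"
  show "measure_pmf.expectation (column_pmf n (Suc q) p)
      (\<lambda>X. potential n m k p (Suc q) (next_history k (table_policy n T) q ?h (?V X))) =
      potential n m k p q ?h"
  proof (cases "card (selected ?h) = k")
    case True
    then show ?thesis
      using potential_stopped[OF True, of n m p q "Suc q"] by (simp add: next_history_def)
  next
    case False
    then have less: "card (selected ?h) < k"
      using table_policy_card_selected[of q P] assms by simp
    have "Suc (m - Suc q) = m - q"
      using assms by simp
    moreover have "measure_pmf.expectation (column_pmf n (Suc q) p)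
        (\<lambda>X. potential n m k p (Suc q) (next_history k (table_policy n T) q ?h (?V X))) =
      real n - real (card (uncovered n ?h)) +
      gain p (Suc (m - Suc q)) (k - card (selected ?h)) (card (uncovered n ?h))"
      unfolding next_history_def if_not_P[OF False] potential_snoc[OF assms less]
        table_policy_play[OF assms less]
      by (rule expectation_optimal_action[OF p uncovered_subset])
    ultimately show ?thesis
      by (simp only: potential_def)
  qed
qed

lemma expected_score_table_policy: "expected_score n m k p (table_policy n T) = gain p m k n"
proof -
  have "measure_pmf.expectation (profile_pmf n q p)
      (\<lambda>P. potential n m k p q (play n k (table_policy n T) P q)) = gain p m k n" if "q \<le> m" for q
    using that
  proof (induction q)
    case 0
    show ?case by (simp only: expectation_potential_0)
  next
    case (Suc q)
    then show ?case
      using expectation_potential_Suc_eq[of q] by simp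
  qed
  then show ?thesis
    using expectation_potential_final[OF safe_table_policy] by (metis order_refl)
qed

lemma optimal_safe_table_policy: "optimal_safe n m k p (table_policy n T)"
  using safe_table_policy expected_score_table_policy expected_score_le_gain[OF p]
  by (simp add: optimal_safe_def)

end


section \<open>Symbolic execution with running time\<close>

text \<open>Total correctness with running time: the postcondition also receives the cost. The rules
  below are equivalences, so that the simplifier can execute loop-free code.\<close>

definition wp :: "com \<Rightarrow> memory \<Rightarrow> (nat \<Rightarrow> memory \<Rightarrow> bool) \<Rightarrow> bool" where
  "wp c s Q \<longleftrightarrow> (\<exists>t s'. exec c s t s' \<and> Q t s')"

lemma wp_mono:
  assumes "wp c s Q" "\<And>t s'. Q t s' \<Longrightarrow> R t s'"
  shows "wp c s R"
  using assms by (auto simp: wp_def)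

lemma wp_NAssign [simp]:
  "wp (NAssign x a) s Q \<longleftrightarrow> Q (1 + ncost a) (s\<lparr>nreg := (nreg s)(x := nval a s)\<rparr>)"
proof
  assume "wp (NAssign x a) s Q"
  then show "Q (1 + ncost a) (s\<lparr>nreg := (nreg s)(x := nval a s)\<rparr>)"
    unfolding wp_def by (elim exE conjE exec_NAssignE) simp
qed (unfold wp_def, intro exI conjI, rule exec_NAssign)

lemma wp_RAssign [simp]:
  "wp (RAssign A is e) s Q \<longleftrightarrow> Q (1 + sum_list (map ncost is) + rcost e)
     (s\<lparr>rarr := (rarr s)(A := (rarr s A)(map (\<lambda>i. nval i s) is := rval e s))\<rparr>)"
proof
  assume "wp (RAssign A is e) s Q"
  then show "Q (1 + sum_list (map ncost is) + rcost e)
      (s\<lparr>rarr := (rarr s)(A := (rarr s A)(map (\<lambda>i. nval i s) is := rval e s))\<rparr>)"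
    unfolding wp_def by (elim exE conjE exec_RAssignE) simp
qed (unfold wp_def, intro exI conjI, rule exec_RAssign[OF refl])

lemma wp_Seq [simp]:
  "wp (Seq c d) s Q \<longleftrightarrow> wp c s (\<lambda>t s'. wp d s' (\<lambda>u. Q (t + u)))"
  unfolding wp_def by (blast intro: exec_Seq elim: exec_SeqE)

lemma wp_If [simp]:
  "wp (If b c d) s Q \<longleftrightarrow>
     (if bval b s then wp c s (\<lambda>t. Q (1 + bcost b + t)) else wp d s (\<lambda>t. Q (1 + bcost b + t)))"
proof
  assume "wp (If b c d) s Q"
  then show "if bval b s then wp c s (\<lambda>t. Q (1 + bcost b + t))
      else wp d s (\<lambda>t. Q (1 + bcost b + t))"
    unfolding wp_def by (elim exE conjE exec_IfE) auto
next
  assume "if bval b s then wp c s (\<lambda>t. Q (1 + bcost b + t))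
      else wp d s (\<lambda>t. Q (1 + bcost b + t))"
  then show "wp (If b c d) s Q"
    unfolding wp_def using exec_IfTrue exec_IfFalse by meson
qed

definition For :: "vname \<Rightarrow> nexp \<Rightarrow> com \<Rightarrow> com" where
  "For x b c = Seq (NAssign x (NConst 0))
     (While (BNLess (NVar x) b) (Seq c (NAssign x (NAdd (NVar x) (NConst 1)))))"

text \<open>A round costs at most T for the body, 4 for the increment and \<open>3 + ncost b\<close>
  for the test; initialising the counter costs 2 and the last, failing test
  \<open>3 + ncost b\<close>. The frame premise lets the loop change its counter without disturbing
  the invariant.\<close>

lemma wp_For:
  assumes init: "I 0 s"
    and bound: "\<And>i s. I i s \<Longrightarrow> nval b s = N"
    and frame: "\<And>i s v. I i s \<Longrightarrow> I i (s\<lparr>nreg := (nreg s)(x := v)\<rparr>)"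
    and body: "\<And>i s. i < N \<Longrightarrow> I i s \<Longrightarrow> nreg s x = i \<Longrightarrow>
      wp c s (\<lambda>t s'. t \<le> T \<and> nreg s' x = i \<and> I (Suc i) s')"
  shows "wp (For x b c) s (\<lambda>t s'. t \<le> 5 + ncost b + N * (T + 7 + ncost b) \<and> I N s')"
proof -
  let ?loop = "While (BNLess (NVar x) b) (Seq c (NAssign x (NAdd (NVar x) (NConst 1))))"
  have loop: "wp ?loop s (\<lambda>t s'. t \<le> 3 + ncost b + (N - i) * (T + 7 + ncost b) \<and> I N s')"
    if "i \<le> N" "I i s" "nreg s x = i" for i s
    using that
  proof (induction "N - i" arbitrary: i s)
    case 0
    then have "exec ?loop s (1 + bcost (BNLess (NVar x) b)) s"
      using bound[OF \<open>I i s\<close>] by (intro exec_WhileFalse) simp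
    then show ?case
      using 0 unfolding wp_def by fastforce
  next
    case (Suc d)
    then have i: "i < N"
      by simp
    obtain t s1 where t: "exec c s t s1" "t \<le> T" "nreg s1 x = i" "I (Suc i) s1"
      using body[OF i Suc.prems(2,3)] by (auto simp: wp_def)
    let ?s2 = "s1\<lparr>nreg := (nreg s1)(x := Suc i)\<rparr>"
    have "exec (NAssign x (NAdd (NVar x) (NConst 1))) s1 (1 + ncost (NAdd (NVar x) (NConst 1)))
        (s1\<lparr>nreg := (nreg s1)(x := nval (NAdd (NVar x) (NConst 1)) s1)\<rparr>)"
      by (rule exec_NAssign)
    then have "exec (Seq c (NAssign x (NAdd (NVar x) (NConst 1)))) s (t + 4) ?s2"
      using exec_Seq[OF t(1)] t(3) by (fastforce simp: numeral_eq_Suc)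
    moreover have "wp ?loop ?s2
        (\<lambda>t s'. t \<le> 3 + ncost b + (N - Suc i) * (T + 7 + ncost b) \<and> I N s')"
      using Suc.hyps i frame[OF t(4)] by (intro Suc.hyps(1)) auto
    then obtain u s3 where u: "exec ?loop ?s2 u s3" "I N s3"
        "u \<le> 3 + ncost b + (N - Suc i) * (T + 7 + ncost b)"
      by (auto simp: wp_def)
    ultimately have "exec ?loop s (1 + bcost (BNLess (NVar x) b) + (t + 4) + u) s3"
      using i Suc.prems bound[OF Suc.prems(2)] by (intro exec_WhileTrue[OF _ _ u(1)]) auto
    moreover have "N - i = Suc (N - Suc i)"
      using i by simp
    then have "1 + bcost (BNLess (NVar x) b) + (t + 4) + u \<le>
        3 + ncost b + (N - i) * (T + 7 + ncost b)"
      using u(3) t(2) by simp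
    ultimately show ?case
      using u(2) unfolding wp_def by blast
  qed
  show ?thesis
    unfolding For_def using loop[of 0, OF _ frame[OF init, of 0]]
    by (auto elim!: wp_mono)
qed


section \<open>The program\<close>

lemma binom_weight_Suc_0: "binom_weight p (Suc d) 0 = (1 - p) * binom_weight p d 0"
  by (simp add: binom_weight_def)

lemma binom_weight_Suc_Suc:
  "binom_weight p (Suc d) (Suc g) = p * binom_weight p d g + (1 - p) * binom_weight p d (Suc g)"
proof (cases "g < d")
  \<comment> \<open>The truncated exponent d - g yields a factor 1 - p only for g < d; otherwise
    \<open>d choose Suc g\<close> is 0.\<close>
  case True
  then have "d - g = Suc (d - Suc g)"
    by simp
  then show ?thesis
    by (simp add: binom_weight_def algebra_simps)
next
  case False
  then show ?thesis
    by (auto simp: binom_weight_def not_less le_less binomial_eq_0)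
qed

text \<open>Shifting the second index by one gives Pascal's recurrence a zeroth column of zeros, so that
  the program needs no case distinction.\<close>

definition shifted_weight :: "real \<Rightarrow> nat \<Rightarrow> nat \<Rightarrow> real" where
  "shifted_weight p d g = (if g = 0 then 0 else binom_weight p d (g - 1))"

lemma shifted_weight_0: "shifted_weight p 0 g = (if g = 1 then 1 else 0)"
  by (auto simp: shifted_weight_def binom_weight_def)

lemma shifted_weight_0_right: "shifted_weight p d 0 = 0"
  by (simp add: shifted_weight_def)

lemma shifted_weight_Suc_Suc:
  "shifted_weight p (Suc d) (Suc g) = p * shifted_weight p d g + (1 - p) * shifted_weight p d (Suc g)"
  by (cases g) (simp_all add: shifted_weight_def binom_weight_Suc_0 binom_weight_Suc_Suc)

section \<open>The dynamic program in the real RAM language\<close>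

abbreviation var_plus :: "vname \<Rightarrow> nat \<Rightarrow> nexp" where
  "var_plus x c \<equiv> NAdd (NVar x) (NConst c)"

text \<open>Shifted columns run from 0 to n + 1, hence n + 2 cells. The single 1 in column 1 is the
  weight of zero approvals among zero voters.\<close>

definition pascal_init :: com where
  "pascal_init = Seq
     (For ''g'' (var_plus ''n'' 2) (RAssign ''b'' [NConst 0, NVar ''g''] (RNat (NConst 0))))
     (RAssign ''b'' [NConst 0, NConst 1] (RNat (NConst 1)))"

text \<open>Every row is filled to full width, including the zeros beyond the diagonal, so the
  recurrence never reads an unwritten cell.\<close>

definition pascal_row :: com where
  "pascal_row = Seq
     (RAssign ''b'' [var_plus ''d'' 1, NConst 0] (RNat (NConst 0)))
     (For ''g'' (var_plus ''n'' 1) (RAssign ''b'' [var_plus ''d'' 1, var_plus ''g'' 1]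
       (RAdd (RMul (RCell ''p'' []) (RCell ''b'' [NVar ''d'', NVar ''g'']))
         (RMul (RSub (RNat (NConst 1)) (RCell ''p'' []))
           (RCell ''b'' [NVar ''d'', var_plus ''g'' 1])))))"

definition gain_init :: com where
  "gain_init = For ''j'' (var_plus ''k'' 1) (For ''d'' (var_plus ''n'' 1)
     (RAssign ''w'' [NConst 0, NVar ''j'', NVar ''d''] (RNat (NConst 0))))"

abbreviation old_gain :: rexp where
  "old_gain \<equiv> RCell ''w'' [NVar ''r'', NVar ''j'', NVar ''d'']"

text \<open>The disjunction in \<open>takes\<close> is expressed by De Morgan, the language having
  only negation and conjunction. The case j = 0 occurs because \<open>states\<close> contains
  \<beta> = k; then j - 1 truncates to 0 and the guard forces no.\<close>

definition decide :: com where
  "decide = Seq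
     (RAssign ''y'' [] (RAdd (RNat (NVar ''g''))
       (RCell ''w'' [NVar ''r'', NSub (NVar ''j'') (NConst 1), NSub (NVar ''d'') (NVar ''g'')])))
     (If (BAnd (BNLess (NConst 0) (NVar ''j''))
           (BNot (BAnd (BNot (BNLess (NVar ''r'') (NVar ''j'')))
             (BNot (BRLess old_gain (RCell ''y'' []))))))
       (Seq
         (RAssign ''action'' [NSub (NVar ''m'') (NVar ''r''), NSub (NVar ''k'') (NVar ''j''),
           NVar ''g'', NVar ''d''] (RNat (NConst 1)))
         (RAssign ''acc'' [] (RAdd (RCell ''acc'' [])
           (RMul (RCell ''b'' [NVar ''d'', var_plus ''g'' 1]) (RCell ''y'' [])))))
       (Seq
         (RAssign ''action'' [NSub (NVar ''m'') (NVar ''r''), NSub (NVar ''k'') (NVar ''j''),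
           NVar ''g'', NVar ''d''] (RNat (NConst 0)))
         (RAssign ''acc'' [] (RAdd (RCell ''acc'' [])
           (RMul (RCell ''b'' [NVar ''d'', var_plus ''g'' 1]) old_gain)))))"

definition gain_cell :: com where
  "gain_cell = Seq (RAssign ''acc'' [] (RNat (NConst 0)))
     (Seq (For ''g'' (var_plus ''d'' 1) decide)
       (RAssign ''w'' [var_plus ''r'' 1, NVar ''j'', NVar ''d''] (RCell ''acc'' [])))"

text \<open>Row r + 1 of the gains is computed from row r. In total there are at most m (k + 1) (n +
  1)^2 runs of \<open>decide\<close>, each of constant cost.\<close>

definition program :: com where
  "program = Seq pascal_init (Seq (For ''d'' (NVar ''n'') pascal_row)
     (Seq gain_init
       (For ''r'' (NVar ''m'') (For ''j'' (var_plus ''k'' 1)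
         (For ''d'' (var_plus ''n'' 1) gain_cell)))))"


section \<open>Correctness and running time of the program\<close>

context
  fixes n m k :: nat and p :: real
begin

section \<open>Invariants of the nested loops\<close>

definition pascal_inv :: "nat \<Rightarrow> memory \<Rightarrow> bool" where
  "pascal_inv D s \<longleftrightarrow> input_memory n m k p s \<and>
     (\<forall>d\<le>D. \<forall>g\<le>Suc n. rarr s ''b'' [d, g] = shifted_weight p d g)"

definition gain_row :: "nat \<Rightarrow> nat \<Rightarrow> memory \<Rightarrow> bool" where
  "gain_row r J s \<longleftrightarrow> (\<forall>j<J. \<forall>d\<le>n. rarr s ''w'' [r, j, d] = gain p r j d)"

definition action_cells :: "nat \<Rightarrow> nat \<Rightarrow> nat \<Rightarrow> nat \<Rightarrow> memory \<Rightarrow> bool" where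
  "action_cells r j d G s \<longleftrightarrow>
     (\<forall>g<G. rarr s ''action'' [m - r, k - j, g, d] = of_bool (takes p r j g d))"

text \<open>Only gain row r is retained, as the next row depends on nothing older; the action
  entries of all earlier rounds are retained because they are the output.\<close>

definition row_inv :: "nat \<Rightarrow> memory \<Rightarrow> bool" where
  "row_inv r s \<longleftrightarrow> pascal_inv n s \<and> gain_row r (Suc k) s \<and>
     (\<forall>r'<r. \<forall>j\<le>k. \<forall>d\<le>n. action_cells r' j d (Suc d) s)"

text \<open>This and the next two invariants each contain the enclosing one and fix the enclosing
  counter, but leave their own counter free, as \<open>wp_For\<close> demands.\<close>

definition seat_inv :: "nat \<Rightarrow> nat \<Rightarrow> memory \<Rightarrow> bool" where
  "seat_inv r j s \<longleftrightarrow> row_inv r s \<and> nreg s ''r'' = r \<and> gain_row (Suc r) j s \<and>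
     (\<forall>j'<j. \<forall>d\<le>n. action_cells r j' d (Suc d) s)"

definition voter_inv :: "nat \<Rightarrow> nat \<Rightarrow> nat \<Rightarrow> memory \<Rightarrow> bool" where
  "voter_inv r j d s \<longleftrightarrow> seat_inv r j s \<and> nreg s ''j'' = j \<and>
     (\<forall>d'<d. rarr s ''w'' [Suc r, j, d'] = gain p (Suc r) j d' \<and> action_cells r j d' (Suc d') s)"

text \<open>At g = \<open>Suc d\<close> the accumulator holds the full sum defining
  \<open>gain p (Suc r) j d\<close>.\<close>

definition cell_inv :: "nat \<Rightarrow> nat \<Rightarrow> nat \<Rightarrow> nat \<Rightarrow> memory \<Rightarrow> bool" where
  "cell_inv r j d g s \<longleftrightarrow> voter_inv r j d s \<and> nreg s ''d'' = d \<and> action_cells r j d g s \<and>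
     rarr s ''acc'' [] =
       (\<Sum>g'<g. binom_weight p d g' * action_value p r j g' d (takes p r j g' d))"

lemmas inv_defs = cell_inv_def voter_inv_def seat_inv_def row_inv_def action_cells_def
  gain_row_def pascal_inv_def input_memory_def

section \<open>Verification of the loops, from the inside out\<close>

lemma wp_pascal_init:
  assumes "input_memory n m k p s"
  shows "wp pascal_init s (\<lambda>t s'. t \<le> 50 * (n + 1) \<and> pascal_inv 0 s')"
proof -
  have "wp (For ''g'' (var_plus ''n'' 2) (RAssign ''b'' [NConst 0, NVar ''g''] (RNat (NConst 0)))) s
      (\<lambda>t s'. t \<le> 5 + ncost (var_plus ''n'' 2) + (n + 2) * (5 + 7 + ncost (var_plus ''n'' 2)) \<and>
        (input_memory n m k p s' \<and> (\<forall>g<n + 2. rarr s' ''b'' [0, g] = 0)))"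
    by (rule wp_For) (use assms in \<open>auto simp: input_memory_def less_Suc_eq\<close>)
  then show ?thesis
    unfolding pascal_init_def wp_Seq
    by (rule wp_mono) (auto simp: pascal_inv_def input_memory_def shifted_weight_0)
qed

lemma gain_row_Suc:
  "gain_row r (Suc j) s \<longleftrightarrow>
     gain_row r j s \<and> (\<forall>d\<le>n. rarr s ''w'' [r, j, d] = gain p r j d)"
  by (auto simp: gain_row_def less_Suc_eq)

lemma action_cells_Suc:
  "action_cells r j d (Suc g) s \<longleftrightarrow> action_cells r j d g s \<and>
     rarr s ''action'' [m - r, k - j, g, d] = of_bool (takes p r j g d)"
  by (auto simp: action_cells_def less_Suc_eq)

lemma voter_inv_Suc:
  "voter_inv r j (Suc d) s \<longleftrightarrow> voter_inv r j d s \<and>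
     rarr s ''w'' [Suc r, j, d] = gain p (Suc r) j d \<and> action_cells r j d (Suc d) s"
  by (auto simp: voter_inv_def less_Suc_eq)

lemma seat_inv_Suc:
  "seat_inv r (Suc j) s \<longleftrightarrow> seat_inv r j s \<and>
     (\<forall>d\<le>n. rarr s ''w'' [Suc r, j, d] = gain p (Suc r) j d) \<and>
     (\<forall>d\<le>n. action_cells r j d (Suc d) s)"
  by (auto simp: seat_inv_def gain_row_Suc less_Suc_eq simp del: gain.simps)

lemma row_inv_Suc:
  "row_inv (Suc r) s \<longleftrightarrow> pascal_inv n s \<and> gain_row (Suc r) (Suc k) s \<and>
     (\<forall>r'<r. \<forall>j\<le>k. \<forall>d\<le>n. action_cells r' j d (Suc d) s) \<and>
     (\<forall>j\<le>k. \<forall>d\<le>n. action_cells r j d (Suc d) s)"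
  by (auto simp: row_inv_def less_Suc_eq)

lemma wp_pascal_row:
  assumes "pascal_inv D s" "nreg s ''d'' = D"
  shows "wp pascal_row s (\<lambda>t s'. t \<le> 60 * (n + 1) \<and> nreg s' ''d'' = D \<and> pascal_inv (Suc D) s')"
proof -
  let ?s = "s\<lparr>rarr := (rarr s)(''b'' := (rarr s ''b'')([Suc D, 0] := 0))\<rparr>"
  \<comment> \<open>Column 0 is written before the loop, so the bound G is inclusive and round g
    adds column \<open>Suc g\<close>.\<close>
  let ?I = "\<lambda>G s'. pascal_inv D s' \<and> nreg s' ''d'' = D \<and>
    (\<forall>g\<le>G. rarr s' ''b'' [Suc D, g] = shifted_weight p (Suc D) g)"
  \<comment> \<open>The body costs exactly 23, rounded up to 30.\<close>
  have "wp (For ''g'' (var_plus ''n'' 1) (RAssign ''b'' [var_plus ''d'' 1, var_plus ''g'' 1]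
       (RAdd (RMul (RCell ''p'' []) (RCell ''b'' [NVar ''d'', NVar ''g'']))
         (RMul (RSub (RNat (NConst 1)) (RCell ''p'' []))
           (RCell ''b'' [NVar ''d'', var_plus ''g'' 1]))))) ?s
      (\<lambda>t s'. t \<le> 5 + ncost (var_plus ''n'' 1) + (n + 1) * (30 + 7 + ncost (var_plus ''n'' 1)) \<and>
        ?I (n + 1) s')"
  proof (rule wp_For[where I = ?I], goal_cases)
    case (4 g s)
    then have "rarr s ''b'' [D, g] = shifted_weight p D g"
      "rarr s ''b'' [D, Suc g] = shifted_weight p D (Suc g)"
      "rarr s ''p'' [] = p" "nreg s ''d'' = D"
      by (auto simp: pascal_inv_def input_memory_def)
    then show ?case
      using 4 by (simp add: pascal_inv_def input_memory_def shifted_weight_Suc_Suc le_Suc_eq)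
  qed (use assms in \<open>auto simp: pascal_inv_def input_memory_def shifted_weight_0_right\<close>)
  then show ?thesis
    unfolding pascal_row_def wp_Seq wp_RAssign using assms
    by (auto elim!: wp_mono simp: pascal_inv_def le_Suc_eq)
qed

lemma wp_gain_init:
  assumes "pascal_inv n s"
  shows "wp gain_init s (\<lambda>t s'. t \<le> 60 * ((k + 1) * (n + 1)) \<and> row_inv 0 s')"
proof -
  have "wp gain_init s (\<lambda>t s'.
      t \<le> 5 + ncost (var_plus ''k'' 1) + (k + 1) * (25 * (n + 1) + 7 + ncost (var_plus ''k'' 1)) \<and>
      (pascal_inv n s' \<and> gain_row 0 (k + 1) s'))"
    unfolding gain_init_def
  proof (rule wp_For[where I = "\<lambda>j s'. pascal_inv n s' \<and> gain_row 0 j s'"], goal_cases)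
    case (4 j s)
    have "wp (For ''d'' (var_plus ''n'' 1)
        (RAssign ''w'' [NConst 0, NVar ''j'', NVar ''d''] (RNat (NConst 0)))) s (\<lambda>t s'.
      t \<le> 5 + ncost (var_plus ''n'' 1) + (n + 1) * (6 + 7 + ncost (var_plus ''n'' 1)) \<and>
      (pascal_inv n s' \<and> gain_row 0 j s' \<and> nreg s' ''j'' = j \<and>
        (\<forall>d<n + 1. rarr s' ''w'' [0, j, d] = 0)))"
      by (rule wp_For) (use 4 in \<open>auto simp: pascal_inv_def input_memory_def gain_row_def less_Suc_eq\<close>)
    then show ?case
      by (rule wp_mono) (simp add: gain_row_Suc less_Suc_eq_le)
  qed (use assms in \<open>auto simp: pascal_inv_def input_memory_def gain_row_def\<close>)
  then show ?thesis
    by (rule wp_mono) (auto simp: row_inv_def algebra_simps)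
qed

text \<open>A single action cell changes, and all action entries recorded so far have other
  indices.\<close>

lemma voter_inv_frame:
  assumes "voter_inv r j d s" "r < m" "j \<le> k"
    and "nreg s' = nreg s" "rarr s' ''p'' [] = rarr s ''p'' []" "rarr s' ''b'' = rarr s ''b''"
      "rarr s' ''w'' = rarr s ''w''"
    and action: "\<And>is. is \<noteq> [m - r, k - j, g, d] \<Longrightarrow> rarr s' ''action'' is = rarr s ''action'' is"
  shows "voter_inv r j d s'"
proof -
  have cells: "action_cells r' j' d' G s'"
    if "action_cells r' j' d' G s" "r' < r \<and> j' \<le> k \<or> r' = r \<and> (j' < j \<or> j' = j \<and> d' < d)"
    for r' j' d' G
  proof -
    \<comment> \<open>For r < m and j \<le> k the truncated differences m - r and k - j still
      determine r and j.\<close>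
    have "[m - r', k - j', g', d'] \<noteq> [m - r, k - j, g, d]" for g'
      using that(2) assms(2,3) by auto
    then show ?thesis
      using that(1) action by (simp add: action_cells_def)
  qed
  have "pascal_inv n s'" "\<And>i J. gain_row i J s' = gain_row i J s"
    using assms(1,4-7)
    by (simp_all add: voter_inv_def seat_inv_def row_inv_def pascal_inv_def input_memory_def gain_row_def)
  then show ?thesis
    using assms(1,4-7) cells unfolding voter_inv_def seat_inv_def row_inv_def by simp
qed

text \<open>The written cell is the first one of row \<open>Suc r\<close> not yet covered by the
  invariant; row r is untouched.\<close>

lemma voter_inv_update:
  assumes "voter_inv r j d s"
  shows "voter_inv r j d (s\<lparr>rarr := (rarr s)(''w'' := (rarr s ''w'')([Suc r, j, d] := v))\<rparr>)"
  using assms by (simp add: inv_defs del: gain.simps)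

text \<open>Both gains that are read lie in the finished row r, since d - g \<le> d \<le> n and j -
  1 \<le> j \<le> k.\<close>

lemma wp_decide:
  assumes "cell_inv r j d g s" "nreg s ''g'' = g" "r < m" "j \<le> k" "d \<le> n" "g \<le> d"
  shows "wp decide s (\<lambda>t s'. t \<le> 100 \<and> nreg s' ''g'' = g \<and> cell_inv r j d (Suc g) s')"
proof -
  have vals: "rarr s ''w'' [r, j, d] = gain p r j d"
    "rarr s ''w'' [r, j - Suc 0, d - g] = gain p r (j - 1) (d - g)"
    "rarr s ''b'' [d, Suc g] = binom_weight p d g"
    and regs: "nreg s ''r'' = r" "nreg s ''j'' = j" "nreg s ''d'' = d" "nreg s ''m'' = m"
      "nreg s ''k'' = k"
    using assms unfolding cell_inv_def voter_inv_def seat_inv_def row_inv_def gain_row_def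
      pascal_inv_def input_memory_def by (simp_all add: shifted_weight_def)
  have step: "cell_inv r j d (Suc g) s'"
    if "nreg s' = nreg s" "rarr s' ''p'' [] = rarr s ''p'' []" "rarr s' ''b'' = rarr s ''b''"
      "rarr s' ''w'' = rarr s ''w''"
      "rarr s' ''action'' = (rarr s ''action'')([m - r, k - j, g, d] := of_bool (takes p r j g d))"
      "rarr s' ''acc'' [] = rarr s ''acc'' [] +
        binom_weight p d g * action_value p r j g d (takes p r j g d)" for s'
  proof -
    have "voter_inv r j d s'"
      using assms that by (intro voter_inv_frame[of r j d s s' g]) (auto simp: cell_inv_def)
    then show ?thesis
      using assms(1) that unfolding cell_inv_def action_cells_Suc
      by (simp add: action_cells_def)
  qed
  show ?thesis
  proof (cases "takes p r j g d")
    case True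
    then show ?thesis
      unfolding decide_def
      by (auto simp: vals regs assms(2) takes_def action_value_def intro!: step)
  next
    case False
    then show ?thesis
      \<comment> \<open>For j = 0 the first guard gives no; for j > 0 both comparisons fail.\<close>
      unfolding decide_def using step vals
      by (cases "j = 0") (auto simp: vals regs assms(2) takes_def action_value_def)
  qed
qed

lemma wp_gain_cell:
  assumes "voter_inv r j d s" "nreg s ''d'' = d" "r < m" "j \<le> k" "d \<le> n"
  shows "wp gain_cell s (\<lambda>t s'. t \<le> 150 * (n + 1) \<and> nreg s' ''d'' = d \<and> voter_inv r j (Suc d) s')"
proof -
  let ?s = "s\<lparr>rarr := (rarr s)(''acc'' := (rarr s ''acc'')([] := 0))\<rparr>"
  have "wp (For ''g'' (var_plus ''d'' 1) decide) ?s
      (\<lambda>t s'. t \<le> 5 + ncost (var_plus ''d'' 1) + (d + 1) * (100 + 7 + ncost (var_plus ''d'' 1)) \<and>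
        cell_inv r j d (d + 1) s')"
  proof (rule wp_For[where I = "cell_inv r j d"], goal_cases)
    case (4 g s)
    then show ?case
      using wp_decide[of r j d g s] assms by simp
  qed (use assms in \<open>simp_all add: inv_defs\<close>)
  \<comment> \<open>3 pays for clearing \<open>acc\<close>, 8 covers the final write to
    \<open>w\<close>.\<close>
  then have "wp (For ''g'' (var_plus ''d'' 1) decide) ?s (\<lambda>t s'. 3 + t + 8 \<le> 150 * (n + 1) \<and>
      nreg s' ''d'' = d \<and> nreg s' ''r'' = r \<and> nreg s' ''j'' = j \<and> voter_inv r j d s' \<and>
      rarr s' ''acc'' [] = gain p (Suc r) j d \<and> action_cells r j d (Suc d) s')"
    by (rule wp_mono)
      (use assms(5) in \<open>auto simp: cell_inv_def voter_inv_def seat_inv_def gain_Suc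
        lessThan_Suc_atMost simp del: gain.simps\<close>)
  then show ?thesis
    unfolding gain_cell_def wp_Seq wp_RAssign
    by (auto elim!: wp_mono simp: voter_inv_Suc voter_inv_update action_cells_def
      simp del: gain.simps)
qed

lemma wp_voter_loop:
  assumes "seat_inv r j s" "nreg s ''j'' = j" "r < m" "j \<le> k"
  shows "wp (For ''d'' (var_plus ''n'' 1) gain_cell) s
    (\<lambda>t s'. t \<le> 170 * ((n + 1) * (n + 1)) \<and> nreg s' ''j'' = j \<and> seat_inv r (Suc j) s')"
proof -
  have "wp (For ''d'' (var_plus ''n'' 1) gain_cell) s (\<lambda>t s'.
      t \<le> 5 + ncost (var_plus ''n'' 1) + (n + 1) * (150 * (n + 1) + 7 + ncost (var_plus ''n'' 1)) \<and>
      voter_inv r j (n + 1) s')"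
  proof (rule wp_For[where I = "voter_inv r j"], goal_cases)
    case (4 d s)
    then show ?case
      using wp_gain_cell[of r j d s] assms by simp
  qed (use assms in \<open>simp_all add: inv_defs\<close>)
  then show ?thesis
  proof (rule wp_mono, elim conjE, intro conjI, goal_cases)
    case (3 t s')
    then show ?case
      by (simp add: voter_inv_def seat_inv_Suc less_Suc_eq_le del: gain.simps)
  qed (auto simp: voter_inv_def algebra_simps)
qed

lemma wp_seat_loop:
  assumes "row_inv r s" "nreg s ''r'' = r" "r < m"
  shows "wp (For ''j'' (var_plus ''k'' 1) (For ''d'' (var_plus ''n'' 1) gain_cell)) s
    (\<lambda>t s'. t \<le> 190 * ((k + 1) * ((n + 1) * (n + 1))) \<and> nreg s' ''r'' = r \<and> row_inv (Suc r) s')"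
proof -
  have "wp (For ''j'' (var_plus ''k'' 1) (For ''d'' (var_plus ''n'' 1) gain_cell)) s (\<lambda>t s'.
      t \<le> 5 + ncost (var_plus ''k'' 1) +
        (k + 1) * (170 * ((n + 1) * (n + 1)) + 7 + ncost (var_plus ''k'' 1)) \<and>
      seat_inv r (k + 1) s')"
  proof (rule wp_For[where I = "seat_inv r"], goal_cases)
    case (4 j s)
    then show ?case
      using wp_voter_loop[of r j s] assms by simp
  qed (use assms in \<open>simp_all add: inv_defs\<close>)
  then show ?thesis
  proof (rule wp_mono, elim conjE, intro conjI, goal_cases)
    case (3 t s')
    then show ?case
      by (simp add: seat_inv_def row_inv_def[of r] row_inv_Suc less_Suc_eq_le)
  qed (auto simp: seat_inv_def algebra_simps)
qed

lemma wp_program: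
  assumes "input_memory n m k p s"
  shows "wp program s
    (\<lambda>t s'. t \<le> 500 * ((m + 1) * ((k + 1) * ((n + 1) * (n + 1)))) \<and> row_inv m s')"
proof -
  have pascal: "wp (For ''d'' (NVar ''n'') pascal_row) s
      (\<lambda>t s'. t \<le> 5 + ncost (NVar ''n'') + n * (60 * (n + 1) + 7 + ncost (NVar ''n'')) \<and>
        pascal_inv n s')" if "pascal_inv 0 s" for s
  proof (rule wp_For[where I = pascal_inv], goal_cases)
    case (4 d s)
    then show ?case
      using wp_pascal_row[of d s] by simp
  qed (use that in \<open>simp_all add: inv_defs\<close>)
  have main: "wp (For ''r'' (NVar ''m'')
        (For ''j'' (var_plus ''k'' 1) (For ''d'' (var_plus ''n'' 1) gain_cell))) s
      (\<lambda>t s'. t \<le> 5 + ncost (NVar ''m'') +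
          m * (190 * ((k + 1) * ((n + 1) * (n + 1))) + 7 + ncost (NVar ''m'')) \<and>
        row_inv m s')" if "row_inv 0 s" for s
  proof (rule wp_For[where I = row_inv], goal_cases)
    case (4 r s)
    then show ?case
      using wp_seat_loop[of r s] by simp
  qed (use that in \<open>simp_all add: inv_defs\<close>)
  let ?N = "n + 1" and ?K = "k + 1"
  have time: "t1 + (t2 + (t3 + t4)) \<le> 500 * ((m + 1) * (?K * (?N * ?N)))"
    if "t1 \<le> 50 * ?N" "t2 \<le> 6 + n * (60 * ?N + 8)" "t3 \<le> 60 * (?K * ?N)"
      "t4 \<le> 6 + m * (190 * (?K * (?N * ?N)) + 8)" for t1 t2 t3 t4
  proof -
    \<comment> \<open>X is, up to a constant, the cost of one round of the main loop; it also bounds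
      the three preparatory phases.\<close>
    define X where "X = ?K * (?N * ?N)"
    have N: "?N * ?N \<le> X" "?N \<le> X" and "1 \<le> X"
      unfolding X_def by (simp_all add: algebra_simps)
    have "t1 \<le> 50 * X"
      using that(1) mult_le_mono2[OF N(2), of 50] by (rule order_trans)
    moreover have "n * (60 * ?N + 8) \<le> 68 * (?N * ?N)"
      by (simp add: algebra_simps)
    then have "n * (60 * ?N + 8) \<le> 68 * X"
      using mult_le_mono2[OF N(1), of 68] by (rule order_trans)
    then have "t2 \<le> 74 * X"
      using that(2) \<open>1 \<le> X\<close> by linarith
    moreover have "?K * ?N \<le> X"
      unfolding X_def by (intro mult_le_mono order_refl) simp
    then have "t3 \<le> 60 * X"
      using that(3) by linarith
    moreover have "m * (190 * X + 8) \<le> m * (198 * X)"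
      by (rule mult_le_mono2) (use \<open>1 \<le> X\<close> in simp)
    then have "t4 \<le> 6 * X + 198 * (m * X)"
      using that(4) \<open>1 \<le> X\<close> unfolding X_def[symmetric] mult.left_commute[of m 198] by linarith
    ultimately have "t1 + (t2 + (t3 + t4)) \<le> 300 * X + 198 * (m * X)"
      by linarith
    also have "\<dots> \<le> 500 * ((m + 1) * X)"
      by (simp add: algebra_simps)
    finally show ?thesis
      by (simp add: X_def)
  qed
  show ?thesis
    unfolding program_def wp_Seq
    by (rule wp_mono[OF wp_pascal_init[OF assms]], elim conjE,
        rule wp_mono[OF pascal], assumption, elim conjE,
        rule wp_mono[OF wp_gain_init], assumption, elim conjE,
        rule wp_mono[OF main], assumption)
      (use time in simp)
qed

lemma row_inv_output:
  assumes "row_inv m s" "k \<le> m" "0 \<le> p" "p \<le> 1"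
  shows "outputs_optimal_policy n m k p s"
proof -
  have out: "output_table s (a, b, c, d) = of_bool (takes p (m - a) (k - b) c d)"
    if "(a, b, c, d) \<in> states n m k" for a b c d
  proof -
    \<comment> \<open>a \<ge> 1 gives m - a < m, while a \<le> m and b \<le> k undo the double
      subtractions. Hence every state is a cell filled by the main loop.\<close>
    have *: "m - a < m" "k - b \<le> k" "d \<le> n" "c < Suc d" "m - (m - a) = a" "k - (k - b) = b"
      using that by (auto simp: states_def)
    then have "action_cells (m - a) (k - b) d (Suc d) s"
      using assms(1) unfolding row_inv_def by blast
    then show ?thesis
      using * unfolding action_cells_def output_table_def by simp
  qed
  then have "optimal_table n m k p (\<lambda>x. output_table s x = 1)"
    by (auto simp: optimal_table_def)
  then show ?thesis
    using out assms(2-4) optimal_safe_table_policy by (auto simp: outputs_optimal_policy_def)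
qed

end

text \<open>If n or k is 0, the product vanishes although every run takes at least one step; the
  time bound is therefore restricted to positive n and k, while correctness is not.\<close>

theorem proposition4p2:
  "\<exists>(prog :: com) (C :: nat). \<forall>(n :: nat) (m :: nat) (k :: nat) (p :: real) (s :: memory).
     k \<le> m \<longrightarrow> 0 \<le> p \<longrightarrow> p \<le> 1 \<longrightarrow> input_memory n m k p s \<longrightarrow>
     (\<exists>t s'. exec prog s t s' \<and>
        outputs_optimal_policy n m k p s' \<and>
        (1 \<le> n \<longrightarrow> 1 \<le> k \<longrightarrow> t \<le> C * (n ^ 3 * k * m)))"
proof (rule exI[of _ program], rule exI[of _ 8000], intro allI impI)
  fix n m k :: nat and p :: real and s :: memory
  assume k: "k \<le> m" and p: "0 \<le> p" "p \<le> 1" and s: "input_memory n m k p s"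
  obtain t s' where t: "exec program s t s'" "row_inv n m k p m s'"
      "t \<le> 500 * ((m + 1) * ((k + 1) * ((n + 1) * (n + 1))))"
    using wp_program[OF s] by (auto simp: wp_def)
  have "t \<le> 8000 * (n ^ 3 * k * m)" if "1 \<le> n" "1 \<le> k"
  proof -
    \<comment> \<open>Each of the four factors at most doubles, since m, k and n are positive. This
      gives 16, and 16 times 500 is 8000.\<close>
    have "(m + 1) * ((k + 1) * ((n + 1) * (n + 1))) \<le> (2 * m) * ((2 * k) * ((2 * n) * (2 * n)))"
      using that k by (intro mult_le_mono) auto
    also have "\<dots> = 16 * (n ^ 2 * k * m)"
      by (simp add: power2_eq_square)
    also have "\<dots> \<le> 16 * (n ^ 3 * k * m)"
      using that by (intro mult_le_mono power_increasing) auto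
    finally show ?thesis
      using t(3) by simp
  qed
  then show "\<exists>t s'. exec program s t s' \<and> outputs_optimal_policy n m k p s' \<and>
      (1 \<le> n \<longrightarrow> 1 \<le> k \<longrightarrow> t \<le> 8000 * (n ^ 3 * k * m))"
    using t(1) row_inv_output[OF t(2) k p] by blast
qed

end
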